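(* Let $X$ be a countably infinite set. Every ideal clone on $X$ contains a maximal proper subclone which is itself an ideal clone; that is, for every ideal $I$ on $X$ there is an ideal $J$ on $X$ such that $\mathcal C_J\subsetneq\mathcal C_I$ and there is no clone $\mathcal D$ with $\mathcal C_J\subsetneq\mathcal D\subsetneq\mathcal C_I$.
   Context: Let $\mathcal O^{(n)}$ be the set of all functions $X^n\to X$ ($n\ge 1$) and $\mathcal O=\bigcup_{n\ge1}\mathcal O^{(n)}$. A clone on $X$ is a subset of $\mathcal O$ that contains all projections and is closed under composition. An ideal on $X$ means here a family $I$ of subsets of $X$ that is closed under subsets and finite unions, contains all finite subsets of $X$, contains at least one infinite set, and does not contain all subsets of $X$. For an ideal $I$, $\mathcal C_I=\bigcup_{n\ge1}\{f\in\mathcal O^{(n)}: f[A^n]\in I\text{ for all }A\in I\}$. An ideal clone is a clone of the form $\mathcal C_I$ for some ideal $I$ on $X$ (that is, for some family $I$ of subsets of $X$ that is closed under subsets and finite unions, contains all finite subsets of $X$, contains at least one infinite set, and does not contain all subsets of $X$). *)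

theory Defs
  imports "HOL-Library.FuncSet" "HOL-Library.Countable_Set"
begin

text \<open>The base set \<open>X\<close> is the universe of the type \<open>'a\<close>. Elements of \<open>A\<^sup>n\<close> are lists of length \<open>n\<close>.\<close>

definition tuples :: "nat \<Rightarrow> 'a set \<Rightarrow> 'a list set" where
  "tuples n A = {xs. length xs = n \<and> set xs \<subseteq> A}"

text \<open>
  An operation carries its arity explicitly: it is a pair of some \<open>n \<ge> 1\<close> and a function that is
  \<open>undefined\<close> outside \<open>X\<^sup>n\<close>. Hence operations of different arities are distinct, and operations
  of the same arity are equal iff they agree on \<open>X\<^sup>n\<close>.
\<close>

type_synonym 'a operation = "nat \<times> ('a list \<Rightarrow> 'a)"

definition operations :: "'a operation set" where
  "operations = (SIGMA n:{1..}. tuples n UNIV \<rightarrow>\<^sub>E UNIV)"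

definition projection :: "nat \<Rightarrow> nat \<Rightarrow> 'a list \<Rightarrow> 'a" where
  "projection n k = (\<lambda>xs\<in>tuples n UNIV. xs ! k)"

text \<open>The \<open>n\<close>-ary operation \<open>f(g\<^sub>1, \<dots>, g\<^sub>m)\<close>, where \<open>f\<close> is \<open>m\<close>-ary and \<open>gs = [g\<^sub>1, \<dots>, g\<^sub>m]\<close>
  consists of \<open>n\<close>-ary operations.\<close>

definition composition ::
  "nat \<Rightarrow> ('a list \<Rightarrow> 'a) \<Rightarrow> ('a list \<Rightarrow> 'a) list \<Rightarrow> 'a list \<Rightarrow> 'a" where
  "composition n f gs = (\<lambda>xs\<in>tuples n UNIV. f (map (\<lambda>g. g xs) gs))"

definition clone :: "'a operation set \<Rightarrow> bool" where
  "clone C \<longleftrightarrow>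
     C \<subseteq> operations \<and>
     (\<forall>n k. k < n \<longrightarrow> (n, projection n k) \<in> C) \<and>
     (\<forall>m n f gs. (m, f) \<in> C \<longrightarrow> length gs = m \<longrightarrow> (\<forall>g\<in>set gs. (n, g) \<in> C) \<longrightarrow>
        (n, composition n f gs) \<in> C)"

definition ideal :: "'a set set \<Rightarrow> bool" where
  "ideal I \<longleftrightarrow>
     (\<forall>A\<in>I. \<forall>B. B \<subseteq> A \<longrightarrow> B \<in> I) \<and>
     (\<forall>A\<in>I. \<forall>B\<in>I. A \<union> B \<in> I) \<and>
     (\<forall>A. finite A \<longrightarrow> A \<in> I) \<and>
     (\<exists>A\<in>I. infinite A) \<and>
     (\<exists>A. A \<notin> I)"

definition clone_of :: "'a set set \<Rightarrow> 'a operation set" where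
  "clone_of I = {(n, f) \<in> operations. \<forall>A\<in>I. f ` tuples n A \<in> I}"

lemma clone_clone_of:
  assumes "ideal I"
  shows "clone (clone_of I)"
  unfolding clone_def
proof (intro conjI allI impI)
  show "clone_of I \<subseteq> operations"
    by (auto simp: clone_of_def)
next
  fix n k :: nat
  assume k: "k < n"
  have "projection n k ` tuples n A \<subseteq> A" for A :: "'a set"
    using k by (auto simp: projection_def tuples_def)
  then show "(n, projection n k) \<in> clone_of I"
    using k assms unfolding ideal_def clone_of_def operations_def
    by (auto simp: projection_def)
next
  fix m n :: nat and f :: "'a list \<Rightarrow> 'a" and gs
  assume f: "(m, f) \<in> clone_of I" and len: "length gs = m"
    and gs: "\<forall>g\<in>set gs. (n, g) \<in> clone_of I"
  from f have "m \<ge> 1"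
    by (auto simp: clone_of_def operations_def)
  with len obtain g where "g \<in> set gs"
    by (cases gs) auto
  with gs have n: "n \<ge> 1"
    by (auto simp: clone_of_def operations_def)
  have "composition n f gs ` tuples n A \<in> I" if A: "A \<in> I" for A
  proof -
    define B where "B = (\<Union>g\<in>set gs. g ` tuples n A)"
    have "(\<Union>g\<in>G. g ` tuples n A) \<in> I" if "finite G" "G \<subseteq> set gs" for G
      using that
    proof (induction G rule: finite_induct)
      case empty
      then show ?case using assms by (auto simp: ideal_def)
    next
      case (insert g G)
      then have "g ` tuples n A \<in> I"
        using gs A by (auto simp: clone_of_def)
      then show ?case
        using insert assms by (simp add: ideal_def)
    qed
    then have "B \<in> I"
      by (simp add: B_def)
    then have "f ` tuples m B \<in> I"
      using f by (auto simp: clone_of_def)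
    moreover have "composition n f gs ` tuples n A \<subseteq> f ` tuples m B"
      using len by (auto simp: composition_def tuples_def B_def intro!: imageI; blast)
    ultimately show ?thesis
      using assms by (auto simp: ideal_def)
  qed
  then show "(n, composition n f gs) \<in> clone_of I"
    using n by (auto simp: clone_of_def operations_def composition_def)
qed

end

theory Submission imports Defs begin

text \<open>
  The clone below \<open>\<C>\<^sub>I\<close> is \<open>\<C>\<^sub>J\<close> with \<open>J = I \<inter> P\<close>, where \<open>P\<close> is a prime ideal containing all finite
  sets, that is, the dual of a nonprincipal ultrafilter, and \<open>P\<close> omits some \<open>A \<in> I\<close>.

  For every such \<open>P\<close>, no clone lies strictly between. Let \<open>g\<close> preserve \<open>I\<close> but not \<open>J\<close>, say
  \<open>E = g[B\<^sup>n] \<notin> P\<close> with \<open>B \<in> J\<close>. Any \<open>h\<close> that preserves \<open>I\<close> is obtained from \<open>g\<close> and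
  operations that preserve \<open>J\<close>: where the value of \<open>h\<close> lies in \<open>E\<close>, it is \<open>g\<close> of an
  \<open>n\<close>-tuple in \<open>B\<close>, and choosing that tuple preserves \<open>J\<close> because \<open>B \<in> J\<close>; elsewhere the value of
  \<open>h\<close> lies in the complement of \<open>E\<close>, which is in \<open>P\<close> by primality
  (\<open>clone_above_clone_of_Int\<close>).

  The inclusion \<open>\<C>\<^sub>J \<subseteq> \<C>\<^sub>I\<close> is what restricts \<open>P\<close>. If \<open>f\<close> preserves \<open>J\<close> and \<open>f[B\<^sup>n] \<notin> I\<close> for
  some \<open>B \<in> I\<close>, choose for each value of \<open>f\<close> on \<open>B\<^sup>n\<close> a tuple in \<open>B\<^sup>n\<close> that is mapped to it. On
  some set \<open>C \<notin> I\<close> of values, one coordinate \<open>t\<close> of this choice pulls all members of \<open>P\<close> back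
  into \<open>I\<close> (\<open>coordinate_of_small_boxes\<close>). As \<open>P\<close> is prime and \<open>C \<notin> I\<close>, it
  then consists of exactly those sets whose preimage under \<open>t\<close> is in \<open>I\<close>, so \<open>P\<close> is determined
  by \<open>I\<close> and \<open>t\<close> (\<open>clone_of_Int_subset\<close>). There are only continuum many partial maps \<open>t\<close>, but a
  countable infinite set carries more than continuum many ultrafilters. Therefore some \<open>P\<close> is of
  none of these forms. The counting is done by a diagonal argument over an independent family of
  continuum many sets (\<open>exists_prime_ideal_not_in_range\<close>).
\<close>

section \<open>Prime ideals\<close>

definition prime_ideal :: "'a set set \<Rightarrow> bool" where
  "prime_ideal P \<longleftrightarrow>
     (\<forall>A\<in>P. \<forall>B. B \<subseteq> A \<longrightarrow> B \<in> P) \<and>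
     (\<forall>A\<in>P. \<forall>B\<in>P. A \<union> B \<in> P) \<and>
     (\<forall>A. finite A \<longrightarrow> A \<in> P) \<and>
     UNIV \<notin> P \<and>
     (\<forall>A. A \<in> P \<or> - A \<in> P)"

lemma ideal_subset: "ideal I \<Longrightarrow> A \<in> I \<Longrightarrow> B \<subseteq> A \<Longrightarrow> B \<in> I"
  and ideal_Un: "ideal I \<Longrightarrow> A \<in> I \<Longrightarrow> B \<in> I \<Longrightarrow> A \<union> B \<in> I"
  by (simp_all add: ideal_def)

lemma prime_ideal_subset: "prime_ideal P \<Longrightarrow> A \<in> P \<Longrightarrow> B \<subseteq> A \<Longrightarrow> B \<in> P"
  and prime_ideal_Un: "prime_ideal P \<Longrightarrow> A \<in> P \<Longrightarrow> B \<in> P \<Longrightarrow> A \<union> B \<in> P"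
  and prime_ideal_Compl: "prime_ideal P \<Longrightarrow> A \<notin> P \<Longrightarrow> - A \<in> P"
  unfolding prime_ideal_def by metis+

text \<open>
  By Zorn's lemma there is a maximal family containing \<open>G\<close> without a finite subcover of the
  universe; maximality forces every set or its complement into it, and the closure properties
  of a prime ideal follow, since a violation would give a cover by at most three members.
\<close>

lemma exists_prime_ideal:
  fixes G :: "'a set set"
  assumes no_cover: "\<And>F. finite F \<Longrightarrow> F \<subseteq> G \<Longrightarrow> \<Union>F \<noteq> UNIV"
    and singletons: "\<And>x. {x} \<in> G"
  shows "\<exists>P. prime_ideal P \<and> G \<subseteq> P"
proof -
  define \<A> where "\<A> = {H. G \<subseteq> H \<and> (\<forall>F. finite F \<longrightarrow> F \<subseteq> H \<longrightarrow> \<Union>F \<noteq> UNIV)}"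
  have "\<exists>P\<in>\<A>. \<forall>H\<in>\<A>. P \<subseteq> H \<longrightarrow> H = P"
  proof (rule subset_Zorn_nonempty)
    show "\<A> \<noteq> {}"
      using no_cover by (auto simp: \<A>_def)
  next
    fix \<C> assume "\<C> \<noteq> {}" and chain: "subset.chain \<A> \<C>"
    then have sub: "\<C> \<subseteq> \<A>"
      by (simp add: subset_chain_def)
    have "\<Union>F \<noteq> UNIV" if F: "finite F" "F \<subseteq> \<Union>\<C>" for F
    proof -
      obtain H where "H \<in> \<C>" "F \<subseteq> H"
        using finite_subset_Union_chain[OF F \<open>\<C> \<noteq> {}\<close> chain] by blast
      then show ?thesis
        using sub F by (auto simp: \<A>_def)
    qed
    moreover have "G \<subseteq> \<Union>\<C>"
      using sub \<open>\<C> \<noteq> {}\<close> by (auto simp: \<A>_def)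
    ultimately show "\<Union>\<C> \<in> \<A>"
      by (simp add: \<A>_def)
  qed
  then obtain P where "P \<in> \<A>" and max: "\<And>H. H \<in> \<A> \<Longrightarrow> P \<subseteq> H \<Longrightarrow> H = P"
    by blast
  then have GP: "G \<subseteq> P" and P: "\<And>F. finite F \<Longrightarrow> F \<subseteq> P \<Longrightarrow> \<Union>F \<noteq> UNIV"
    by (auto simp: \<A>_def)
  have cover: "\<exists>F. finite F \<and> F \<subseteq> P \<and> E \<union> \<Union>F = UNIV" if "E \<notin> P" for E
  proof -
    have "insert E P \<notin> \<A>"
      using that max[of "insert E P"] by blast
    then obtain F where F: "finite F" "F \<subseteq> insert E P" "\<Union>F = UNIV"
      using GP by (auto simp: \<A>_def)
    then have "finite (F - {E})" "F - {E} \<subseteq> P" "E \<union> \<Union>(F - {E}) = UNIV"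
      by auto
    then show ?thesis by blast
  qed
  have prime: "E \<in> P \<or> - E \<in> P" for E
  proof (rule ccontr)
    assume "\<not> ?thesis"
    then obtain F F' where "finite F" "F \<subseteq> P" "E \<union> \<Union>F = UNIV"
      "finite F'" "F' \<subseteq> P" "- E \<union> \<Union>F' = UNIV"
      using cover[of E] cover[of "- E"] by blast
    moreover from this have "\<Union>(F \<union> F') = UNIV" by blast
    ultimately show False
      using P[of "F \<union> F'"] by simp
  qed
  have down: "B \<in> P" if "A \<in> P" "B \<subseteq> A" for A B
  proof (rule ccontr)
    assume "B \<notin> P"
    then have "- B \<in> P" using prime by blast
    then show False using P[of "{A, - B}"] that by auto
  qed
  have Un: "A \<union> B \<in> P" if "A \<in> P" "B \<in> P" for A B
  proof (rule ccontr)
    assume "A \<union> B \<notin> P"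
    then have "- (A \<union> B) \<in> P" using prime by blast
    then show False using P[of "{A, B, - (A \<union> B)}"] that by auto
  qed
  have "A \<in> P" if "finite A" for A
    using that
  proof (induction A)
    case empty
    show ?case using singletons GP down[of "{undefined}" "{}"] by blast
  next
    case (insert x A)
    then show ?case using Un[of "{x}" A] singletons[of x] GP by auto
  qed
  moreover have "UNIV \<notin> P"
    using P[of "{UNIV}"] by auto
  ultimately have "prime_ideal P"
    unfolding prime_ideal_def
    by (intro conjI ballI allI impI) (use prime in \<open>simp_all add: down Un\<close>)
  with GP show ?thesis by blast
qed

section \<open>More prime ideals than relations\<close>

text \<open>
  A point codes a finite list \<open>xs\<close> of numbers together with a finite list of possible traces on it,
  and it belongs to the set with index \<open>S\<close> if the trace of \<open>S\<close> on \<open>xs\<close> is listed. Finitely many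
  distinct index sets have distinct traces on a suitable \<open>xs\<close>, so any
  pattern of membership and non-membership can be prescribed for them.
\<close>

lemma exists_independent_family:
  fixes A :: "'a set"
  assumes "infinite A"
  shows "\<exists>F :: nat set \<Rightarrow> 'a set. \<forall>\<S> \<T>. finite \<S> \<longrightarrow> finite \<T> \<longrightarrow> \<S> \<inter> \<T> = {} \<longrightarrow>
           infinite {a\<in>A. (\<forall>S\<in>\<S>. a \<in> F S) \<and> (\<forall>T\<in>\<T>. a \<notin> F T)}"
proof -
  obtain e :: "nat \<Rightarrow> 'a" where e: "inj e" "range e \<subseteq> A"
    using assms infinite_countable_subset by blast
  define p :: "nat list \<times> nat list list \<Rightarrow> 'a" where "p = e \<circ> to_nat"
  have "inj p"
    unfolding p_def using e(1) by (intro inj_compose) auto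
  have "p z \<in> A" for z
    using e(2) by (auto simp: p_def)
  define F where "F S = {p (xs, yss) | xs yss. filter (\<lambda>x. x \<in> S) xs \<in> set yss}" for S
  have p_in_F: "p (xs, yss) \<in> F S \<longleftrightarrow> filter (\<lambda>x. x \<in> S) xs \<in> set yss" for xs yss S
    using \<open>inj p\<close> by (auto simp: F_def inj_eq)
  have "infinite {a\<in>A. (\<forall>S\<in>\<S>. a \<in> F S) \<and> (\<forall>T\<in>\<T>. a \<notin> F T)}"
    if fin: "finite \<S>" "finite \<T>" and disj: "\<S> \<inter> \<T> = {}" for \<S> \<T>
  proof -
    \<comment> \<open>\<open>xs\<close> lists one point separating each \<open>S \<in> \<S>\<close> from each \<open>T \<in> \<T>\<close>.\<close>
    define d where "d S T = (SOME x. (x \<in> S) \<noteq> (x \<in> T))" for S T :: "nat set"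
    have d: "(d S T \<in> S) \<noteq> (d S T \<in> T)" if "S \<noteq> T" for S T
      unfolding d_def by (rule someI_ex) (use that in blast)
    obtain xs where xs: "set xs = (\<lambda>(S, T). d S T) ` (\<S> \<times> \<T>)"
      using finite_list[of "(\<lambda>(S, T). d S T) ` (\<S> \<times> \<T>)"] fin by auto
    obtain yss where yss: "set yss = (\<lambda>S. filter (\<lambda>x. x \<in> S) xs) ` \<S>"
      using finite_list[of "(\<lambda>S. filter (\<lambda>x. x \<in> S) xs) ` \<S>"] fin by auto
    have sep: "filter (\<lambda>x. x \<in> T) xs \<notin> set yss" if T: "T \<in> \<T>" for T
    proof
      assume "filter (\<lambda>x. x \<in> T) xs \<in> set yss"
      then obtain S where S: "S \<in> \<S>" "filter (\<lambda>x. x \<in> T) xs = filter (\<lambda>x. x \<in> S) xs"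
        using yss by auto
      then have "set (filter (\<lambda>x. x \<in> T) xs) = set (filter (\<lambda>x. x \<in> S) xs)"
        by simp
      moreover have "d S T \<in> set xs"
        using S T xs by force
      moreover have "S \<noteq> T"
        using S T disj by blast
      ultimately show False
        using d[of S T] by auto
    qed
    \<comment> \<open>A list longer than \<open>xs\<close> is no trace on \<open>xs\<close>; copies of it give infinitely many codes.\<close>
    define q where "q n = p (xs, replicate n (xs @ [0]) @ yss)" for n
    have "inj q"
    proof (rule injI)
      fix m n assume "q m = q n"
      then have "replicate m (xs @ [0]) @ yss = replicate n (xs @ [0]) @ yss"
        using \<open>inj p\<close> by (simp add: q_def inj_eq)
      then show "m = n"
        by (metis append_same_eq length_replicate)
    qed
    have "filter (\<lambda>x. x \<in> S) xs \<noteq> xs @ [0]" for S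
      using length_filter_le[of "\<lambda>x. x \<in> S" xs] by (metis length_append_singleton not_less_eq_eq order_refl)
    then have "q n \<in> F S \<longleftrightarrow> filter (\<lambda>x. x \<in> S) xs \<in> set yss" for n S
      by (auto simp: q_def p_in_F)
    then have "range q \<subseteq> {a\<in>A. (\<forall>S\<in>\<S>. a \<in> F S) \<and> (\<forall>T\<in>\<T>. a \<notin> F T)}"
      using \<open>\<And>z. p z \<in> A\<close> sep yss by (auto simp: q_def)
    then show ?thesis
      using \<open>inj q\<close> by (meson infinite_super range_inj_infinite)
  qed
  then show ?thesis by blast
qed

text \<open>
  Prime ideals outnumber relations: with an independent family \<open>B R\<close> indexed by the relations,
  one prescribes \<open>B R \<in> P\<close> if and only if \<open>B R \<notin> \<Phi> R\<close>, for all \<open>R\<close> at once.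
  Independence within \<open>A\<close> allows to omit \<open>A\<close> from \<open>P\<close> as well.
\<close>

lemma exists_prime_ideal_not_in_range:
  fixes A :: "'a set" and \<Phi> :: "('a \<times> 'a) set \<Rightarrow> 'a set set"
  assumes "countable (UNIV :: 'a set)" and "infinite A"
  shows "\<exists>P. prime_ideal P \<and> A \<notin> P \<and> P \<notin> range \<Phi>"
proof -
  obtain F :: "nat set \<Rightarrow> 'a set" where F: "\<forall>\<S> \<T>. finite \<S> \<longrightarrow> finite \<T> \<longrightarrow> \<S> \<inter> \<T> = {} \<longrightarrow>
      infinite {a\<in>A. (\<forall>S\<in>\<S>. a \<in> F S) \<and> (\<forall>T\<in>\<T>. a \<notin> F T)}"
    using exists_independent_family[OF \<open>infinite A\<close>] by (elim exE)
  define e where "e = (\<lambda>(x, y). prod_encode (to_nat_on (UNIV :: 'a set) x, to_nat_on (UNIV :: 'a set) y))"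
  have "inj e"
    using assms(1) by (auto simp: inj_def e_def)
  define B where "B R = F (e ` R)" for R
  define D where "D R = (if B R \<in> \<Phi> R then - B R else B R)" for R
  define G where "G = range (\<lambda>x. {x}) \<union> {- A} \<union> range D"
  have no_cover: "\<Union>H \<noteq> UNIV" if H: "finite H" "H \<subseteq> G" for H
  proof -
    obtain Rs where Rs: "finite Rs" "H \<inter> range D = D ` Rs"
      using finite_subset_image[of "H \<inter> range D" D UNIV] H(1) by auto
    \<comment> \<open>A finite subfamily of \<open>G\<close> misses all but finitely many points of the infinite set \<open>W\<close>.\<close>
    define Z where "Z = \<Union>(H \<inter> range (\<lambda>x. {x}))"
    have "finite Z"
      using H by (auto simp: Z_def)
    define W where "W = {a\<in>A. (\<forall>S\<in>(\<lambda>R. e ` R) ` {R\<in>Rs. B R \<in> \<Phi> R}. a \<in> F S) \<and>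
      (\<forall>T\<in>(\<lambda>R. e ` R) ` {R\<in>Rs. B R \<notin> \<Phi> R}. a \<notin> F T)}"
    have "infinite W"
      unfolding W_def by (rule F[rule_format]) (use Rs(1) \<open>inj e\<close> in \<open>auto simp: inj_image_eq_iff\<close>)
    then obtain a where a: "a \<in> W" "a \<notin> Z"
      using \<open>finite Z\<close> by (meson finite_subset subsetI)
    have "a \<notin> D R" if "R \<in> Rs" for R
      using a(1) that by (auto simp: W_def D_def B_def)
    moreover have "a \<notin> - A"
      using a by (simp add: W_def)
    moreover have "\<Union>H \<subseteq> Z \<union> - A \<union> \<Union>(D ` Rs)"
      using H(2) unfolding Rs(2)[symmetric] by (auto simp: G_def Z_def)
    ultimately show ?thesis
      using a(2) by blast
  qed
  obtain P where P: "prime_ideal P" "G \<subseteq> P"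
    using exists_prime_ideal[of G] no_cover by (auto simp: G_def)
  have not_both: "\<not> (E \<in> P \<and> - E \<in> P)" for E
    using P(1) unfolding prime_ideal_def by (metis Compl_partition)
  have "A \<notin> P"
    using not_both[of A] P(2) by (auto simp: G_def)
  moreover have "P \<noteq> \<Phi> R" for R
  proof -
    have "D R \<in> P"
      using P(2) by (auto simp: G_def)
    then show ?thesis
      using not_both[of "B R"] by (auto simp: D_def split: if_splits)
  qed
  ultimately show ?thesis
    using P(1) by blast
qed

section \<open>Cutting an ideal down by a prime ideal\<close>

text \<open>
  If all boxes \<open>G \<times> \<dots> \<times> G\<close> with \<open>G \<in> P\<close> have small preimage in \<open>C\<close>, then all \<open>G \<in> P\<close> have small
  preimage under a single coordinate, after passing to a subset of \<open>C\<close> that is still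
  large. Either the coordinate \<open>i\<close> can be dropped from the boxes, or some \<open>G0\<close> has a large preimage
  \<open>C'\<close> under the box of the others; then \<open>i\<close> works on \<open>C'\<close>, because a point of \<open>C'\<close> whose coordinate
  \<open>i\<close> is in \<open>G\<close> lies over the box of \<open>G \<union> G0\<close>.
\<close>

lemma coordinate_of_small_boxes:
  fixes \<tau> :: "'i \<Rightarrow> 'a \<Rightarrow> 'b"
  assumes "finite S" and "{} \<in> I"
    and down: "\<And>A B. A \<in> I \<Longrightarrow> B \<subseteq> A \<Longrightarrow> B \<in> I"
    and Un: "\<And>G H. G \<in> P \<Longrightarrow> H \<in> P \<Longrightarrow> G \<union> H \<in> P"
    and "P \<noteq> {}" and "C \<notin> I"
    and "\<And>G. G \<in> P \<Longrightarrow> {c\<in>C. \<forall>i\<in>S. \<tau> i c \<in> G} \<in> I"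
  shows "\<exists>i\<in>S. \<exists>C'. C' \<notin> I \<and> (\<forall>G\<in>P. {c\<in>C'. \<tau> i c \<in> G} \<in> I)"
  using assms(1,6,7)
proof (induction S)
  case empty
  then show ?case using \<open>P \<noteq> {}\<close> by auto
next
  case (insert i S)
  show ?case
  proof (cases "\<exists>G0\<in>P. {c\<in>C. \<forall>j\<in>S. \<tau> j c \<in> G0} \<notin> I")
    case True
    then obtain G0 where G0: "G0 \<in> P" "{c\<in>C. \<forall>j\<in>S. \<tau> j c \<in> G0} \<notin> I"
      by blast
    have "{c\<in>{c\<in>C. \<forall>j\<in>S. \<tau> j c \<in> G0}. \<tau> i c \<in> G} \<in> I" if "G \<in> P" for G
      by (rule down[OF insert.prems(2)[OF Un[OF that G0(1)]]]) auto
    then show ?thesis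
      using G0(2) by blast
  next
    case False
    then show ?thesis
      using insert.IH insert.prems(1) by blast
  qed
qed

text \<open>
  The relations \<open>R\<close> stand for graphs of partial functions. If the inclusion failed, the graph of the
  coordinate found by \<open>coordinate_of_small_boxes\<close> would give \<open>P\<close>: if \<open>G\<close> and its complement both
  had preimages in \<open>I\<close>, so would the whole set \<open>C'\<close>, so a set outside \<open>P\<close> has its preimage
  outside \<open>I\<close>.
\<close>

lemma clone_of_Int_subset:
  assumes I: "ideal I" and P: "prime_ideal P"
    and avoid: "P \<notin> range (\<lambda>R. {G. {c. \<exists>g\<in>G. (c, g) \<in> R} \<in> I})"
  shows "clone_of (I \<inter> P) \<subseteq> clone_of I"
proof
  fix x assume x: "x \<in> clone_of (I \<inter> P)"
  obtain n f where nf: "x = (n, f)" by fastforce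
  have down: "\<And>A B. A \<in> I \<Longrightarrow> B \<subseteq> A \<Longrightarrow> B \<in> I" and un: "\<And>A B. A \<in> I \<Longrightarrow> B \<in> I \<Longrightarrow> A \<union> B \<in> I"
    and "{} \<in> I"
    using I by (auto simp: ideal_def)
  have f: "(n, f) \<in> operations" "\<And>A. A \<in> I \<Longrightarrow> A \<in> P \<Longrightarrow> f ` tuples n A \<in> I"
    using x by (auto simp: nf clone_of_def)
  have "f ` tuples n B \<in> I" if B: "B \<in> I" for B
  proof (rule ccontr)
    assume C: "f ` tuples n B \<notin> I"
    define t where "t c = (SOME xs. xs \<in> tuples n B \<and> f xs = c)" for c
    have t: "t c \<in> tuples n B \<and> f (t c) = c" if "c \<in> f ` tuples n B" for c
      unfolding t_def by (rule someI_ex) (use that in blast)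
    have small: "{c\<in>f ` tuples n B. \<forall>i\<in>{..<n}. t c ! i \<in> G} \<in> I" if "G \<in> P" for G
    proof -
      have "B \<inter> G \<in> I" "B \<inter> G \<in> P"
        using B \<open>G \<in> P\<close> down P by (auto simp: prime_ideal_def)
      then have "f ` tuples n (B \<inter> G) \<in> I"
        by (rule f)
      moreover have "{c\<in>f ` tuples n B. \<forall>i\<in>{..<n}. t c ! i \<in> G} \<subseteq> f ` tuples n (B \<inter> G)"
      proof
        fix c assume c: "c \<in> {c\<in>f ` tuples n B. \<forall>i\<in>{..<n}. t c ! i \<in> G}"
        then have "t c \<in> tuples n (B \<inter> G)"
          using t[of c] by (auto simp: tuples_def in_set_conv_nth)
        then show "c \<in> f ` tuples n (B \<inter> G)"
          using t[of c] c by (metis (mono_tags, lifting) CollectD imageI)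
      qed
      ultimately show ?thesis
        by (rule down)
    qed
    have "\<exists>i\<in>{..<n}. \<exists>C'. C' \<notin> I \<and> (\<forall>G\<in>P. {c\<in>C'. t c ! i \<in> G} \<in> I)"
      by (rule coordinate_of_small_boxes[where \<tau> = "\<lambda>i c. t c ! i", OF _ \<open>{} \<in> I\<close> down _ _ C small])
         (use P in \<open>auto simp: prime_ideal_def\<close>)
    then obtain i C' where C': "C' \<notin> I" "\<And>G. G \<in> P \<Longrightarrow> {c\<in>C'. t c ! i \<in> G} \<in> I"
      by blast
    define R where "R = {(c, t c ! i) | c. c \<in> C'}"
    have R: "{c. \<exists>g\<in>G. (c, g) \<in> R} = {c\<in>C'. t c ! i \<in> G}" for G
      by (auto simp: R_def)
    have "G \<in> P" if G: "{c\<in>C'. t c ! i \<in> G} \<in> I" for G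
    proof (rule ccontr)
      assume "G \<notin> P"
      then have "- G \<in> P"
        using P by (auto simp: prime_ideal_def)
      then have "{c\<in>C'. t c ! i \<in> G} \<union> {c\<in>C'. t c ! i \<in> - G} \<in> I"
        using C'(2) G un by blast
      moreover have "{c\<in>C'. t c ! i \<in> G} \<union> {c\<in>C'. t c ! i \<in> - G} = C'"
        by auto
      ultimately show False
        using C'(1) by simp
    qed
    then have "P = {G. {c. \<exists>g\<in>G. (c, g) \<in> R} \<in> I}"
      using C'(2) unfolding R by blast
    then show False
      using avoid by blast
  qed
  then show "x \<in> clone_of I"
    using f(1) by (auto simp: nf clone_of_def)
qed

lemma infinite_subset_in_prime_ideal:
  assumes P: "prime_ideal P" and "infinite A"
  shows "\<exists>B\<subseteq>A. infinite B \<and> B \<in> P"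
proof -
  obtain e :: "nat \<Rightarrow> 'a" where e: "inj e" "range e \<subseteq> A"
    using assms infinite_countable_subset by blast
  define E where "E k = range (\<lambda>n. e (2 * n + k))" for k
  have inf: "infinite (E k)" for k
    unfolding E_def by (rule range_inj_infinite) (use e(1) in \<open>auto intro!: injI dest: injD\<close>)
  have sub: "E k \<subseteq> A" for k
    using e(2) by (auto simp: E_def)
  have "2 * m \<noteq> Suc (2 * n)" for m n :: nat
    by presburger
  then have "E 1 \<subseteq> - E 0"
    using e(1) by (auto simp: E_def inj_eq) metis
  then have "E 0 \<in> P \<or> E 1 \<in> P"
    using P unfolding prime_ideal_def by metis
  then show ?thesis
    using inf sub by blast
qed

text \<open>
  A unary operation that maps an infinite \<open>B \<in> P\<close> onto \<open>A\<close>, and everything else into \<open>A\<close>.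
\<close>

lemma exists_operation_not_in_clone_of_Int:
  assumes I: "ideal I" and P: "prime_ideal P"
    and A: "A \<in> I" "A \<notin> P" "countable A"
  shows "\<exists>x. x \<in> clone_of I \<and> x \<notin> clone_of (I \<inter> P)"
proof -
  have "infinite A"
    using A(2) P by (auto simp: prime_ideal_def)
  then obtain B where B: "B \<subseteq> A" "infinite B" "B \<in> P"
    using infinite_subset_in_prime_ideal[OF P] by blast
  then have "B \<in> I"
    using I A(1) by (auto simp: ideal_def)
  have "countable B"
    using B(1) A(3) countable_subset by blast
  \<comment> \<open>Points outside \<open>B\<close> have default indices, but \<open>from_nat_into A\<close> stays in \<open>A\<close> anyway.\<close>
  define u where "u x = from_nat_into A (to_nat_on B x)" for x
  have range_u: "u x \<in> A" for x
    using \<open>infinite A\<close> by (auto simp: u_def intro: from_nat_into)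
  have "u ` B = from_nat_into A ` to_nat_on B ` B"
    by (auto simp: u_def)
  also have "\<dots> = A"
    using \<open>infinite A\<close> \<open>countable A\<close> \<open>infinite B\<close> \<open>countable B\<close>
    by (metis finite.emptyI image_to_nat_on range_from_nat_into)
  finally have u: "u ` B = A" .
  define f where "f = (\<lambda>xs\<in>tuples 1 UNIV. u (xs ! 0))"
  have f: "(1, f) \<in> operations"
    by (auto simp: f_def operations_def)
  have "f ` tuples 1 D \<subseteq> A" for D
    using range_u by (auto simp: f_def tuples_def)
  then have "(1, f) \<in> clone_of I"
    using f A(1) I unfolding clone_of_def ideal_def by blast
  moreover have "A \<subseteq> f ` tuples 1 B"
  proof
    fix a assume "a \<in> A"
    then obtain b where "b \<in> B" "a = u b"
      using u by blast
    then have "a = f [b]" "[b] \<in> tuples 1 B"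
      by (auto simp: f_def tuples_def)
    then show "a \<in> f ` tuples 1 B" by blast
  qed
  then have "f ` tuples 1 B \<notin> P"
    using P A(2) unfolding prime_ideal_def by blast
  then have "(1, f) \<notin> clone_of (I \<inter> P)"
    using \<open>B \<in> I\<close> \<open>B \<in> P\<close> by (auto simp: clone_of_def)
  ultimately show ?thesis by blast
qed

text \<open>
  Every \<open>h\<close> preserving \<open>I\<close> is a composition \<open>s(x, g(k\<^sub>1(x), \<dots>, k\<^sub>n(x)))\<close> with \<open>s\<close> and all \<open>k\<^sub>i\<close>
  preserving \<open>I \<inter> P\<close>. With \<open>E = g[B\<^sup>n]\<close>, the \<open>k\<^sub>i\<close> choose a tuple in \<open>B\<close> over the value \<open>h(x)\<close> if
  this lies in \<open>E\<close>; and \<open>s(x, y)\<close> is \<open>y\<close> if \<open>h(x) \<in> E\<close> and \<open>h(x)\<close> otherwise. So a value of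
  \<open>s\<close> is its last argument or a value of \<open>h\<close> in \<open>- E\<close>, and \<open>- E \<in> P\<close>.
\<close>

lemma clone_above_clone_of_Int:
  assumes I: "ideal I" and P: "prime_ideal P"
    and D: "clone D" "clone_of (I \<inter> P) \<subseteq> D"
    and g: "(n, g) \<in> D" "(n, g) \<in> clone_of I" "(n, g) \<notin> clone_of (I \<inter> P)"
  shows "clone_of I \<subseteq> D"
proof
  fix x assume x: "x \<in> clone_of I"
  obtain m h where mh: "x = (m, h)" by fastforce
  have m: "m \<ge> 1" and h: "\<And>A. A \<in> I \<Longrightarrow> h ` tuples m A \<in> I" and
    h_ext: "h \<in> extensional (tuples m UNIV)"
    using x by (auto simp: mh clone_of_def operations_def PiE_def)
  have n: "n \<ge> 1"
    using g(2) by (auto simp: clone_of_def operations_def)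
  obtain B where B: "B \<in> I" "B \<in> P" "g ` tuples n B \<notin> P"
    using g(2,3) by (auto simp: clone_of_def)
  define E where "E = g ` tuples n B"
  have "E \<noteq> {}"
    using B(3) P by (auto simp: E_def prime_ideal_def)
  then obtain e where e: "e \<in> E" by blast
  define t where "t c = (SOME xs. xs \<in> tuples n B \<and> g xs = c)" for c
  have t: "t c \<in> tuples n B \<and> g (t c) = c" if "c \<in> E" for c
    unfolding t_def by (rule someI_ex) (use that in \<open>auto simp: E_def\<close>)
  \<comment> \<open>The element \<open>e\<close> of \<open>E\<close> keeps the \<open>k i\<close> inside \<open>B\<close> where \<open>h\<close> leaves \<open>E\<close>.\<close>
  define k where "k i = (\<lambda>xs\<in>tuples m UNIV. t (if h xs \<in> E then h xs else e) ! i)" for i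
  have k: "(m, k i) \<in> D" if "i < n" for i
  proof -
    have "t c ! i \<in> B" if "c \<in> E" for c
      using t[OF that] nth_mem[of i "t c"] \<open>i < n\<close> by (auto simp: tuples_def)
    then have "k i xs \<in> B" if "xs \<in> tuples m UNIV" for xs
      using e that by (simp add: k_def)
    then have "k i ` tuples m A \<subseteq> B" for A
      by (auto simp: tuples_def)
    then have "k i ` tuples m A \<in> I \<inter> P" for A
      using B(1,2) ideal_subset[OF I] prime_ideal_subset[OF P] by (metis IntI)
    then have "(m, k i) \<in> clone_of (I \<inter> P)"
      using m by (auto simp: clone_of_def operations_def k_def)
    then show ?thesis
      using D(2) by blast
  qed
  define gk where "gk = composition m g (map k [0..<n])"
  have gk: "(m, gk) \<in> D"
  proof -
    have "length (map k [0..<n]) = n" "\<forall>f\<in>set (map k [0..<n]). (m, f) \<in> D"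
      using k by auto
    then show ?thesis
      using D(1) g(1) unfolding clone_def gk_def by blast
  qed
  have gk_eq: "gk xs = h xs" if "xs \<in> tuples m UNIV" "h xs \<in> E" for xs
  proof -
    have "length (t (h xs)) = n"
      using t[OF that(2)] by (simp add: tuples_def)
    then have "map (\<lambda>k. k xs) (map k [0..<n]) = t (h xs)"
      using that by (auto simp: k_def intro: nth_equalityI)
    then show ?thesis
      using that t[OF that(2)] by (simp add: gk_def composition_def)
  qed
  define s where "s = (\<lambda>xs\<in>tuples (Suc m) UNIV. if h (butlast xs) \<in> E then last xs else h (butlast xs))"
  have "s ` tuples (Suc m) A \<in> I \<inter> P" if A: "A \<in> I \<inter> P" for A
  proof -
    have "s ` tuples (Suc m) A \<subseteq> A \<union> (h ` tuples m A - E)"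
    proof
      fix y assume "y \<in> s ` tuples (Suc m) A"
      then obtain xs where xs: "y = s xs" "length xs = Suc m" "set xs \<subseteq> A"
        by (auto simp: tuples_def)
      then have "butlast xs \<in> tuples m A" "last xs \<in> A"
        by (auto simp: tuples_def dest: in_set_butlastD) (metis last_in_set length_0_conv nat.distinct(1) subsetD)
      then show "y \<in> A \<union> (h ` tuples m A - E)"
        using xs by (auto simp: s_def tuples_def)
    qed
    moreover have "h ` tuples m A - E \<in> I"
      using h[of A] A by (intro ideal_subset[OF I _ Diff_subset]) simp
    moreover have "- E \<in> P"
      using B(3) prime_ideal_Compl[OF P] by (simp add: E_def)
    then have "h ` tuples m A - E \<in> P"
      by (rule prime_ideal_subset[OF P]) auto
    ultimately show ?thesis
      using A ideal_Un[OF I] ideal_subset[OF I] prime_ideal_Un[OF P] prime_ideal_subset[OF P]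
      by (metis IntD1 IntD2 IntI)
  qed
  then have "(Suc m, s) \<in> clone_of (I \<inter> P)"
    by (auto simp: clone_of_def operations_def s_def)
  then have s: "(Suc m, s) \<in> D"
    using D(2) by blast
  define gs where "gs = map (projection m) [0..<m] @ [gk]"
  have "length gs = Suc m" "\<forall>g\<in>set gs. (m, g) \<in> D"
    using D(1) gk by (auto simp: gs_def clone_def)
  then have "(m, composition m s gs) \<in> D"
    using D(1) s unfolding clone_def by blast
  moreover have "composition m s gs = h"
  proof (rule extensionalityI[OF _ h_ext])
    show "composition m s gs \<in> extensional (tuples m UNIV)"
      by (simp add: composition_def)
  next
    fix xs assume xs: "xs \<in> tuples m (UNIV :: 'a set)"
    then have "map (\<lambda>g. g xs) gs = xs @ [gk xs]"
      by (auto simp: gs_def projection_def tuples_def intro: nth_equalityI)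
    moreover have "xs @ [gk xs] \<in> tuples (Suc m) UNIV"
      using xs by (simp add: tuples_def)
    ultimately show "composition m s gs xs = h xs"
      using xs gk_eq[OF xs] by (auto simp: composition_def s_def)
  qed
  ultimately show "x \<in> D"
    by (simp add: mh)
qed

lemma ideal_Int_prime_ideal:
  assumes I: "ideal I" and P: "prime_ideal P"
  shows "ideal (I \<inter> P)"
proof -
  obtain A where A: "A \<in> I" "infinite A"
    using I by (auto simp: ideal_def)
  then obtain B where "B \<subseteq> A" "infinite B" "B \<in> P"
    using infinite_subset_in_prime_ideal[OF P] by blast
  then have "\<exists>B\<in>I \<inter> P. infinite B"
    using A I unfolding ideal_def by blast
  then show ?thesis
    using I P unfolding ideal_def prime_ideal_def by auto
qed

section \<open>The covering theorem\<close>

theorem proposition9: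
  fixes I :: "'a set set"
  assumes "countable (UNIV :: 'a set)"
    and "infinite (UNIV :: 'a set)"
    and "ideal I"
  shows "\<exists>J :: 'a set set. ideal J \<and> clone_of J \<subset> clone_of I \<and>
           \<not> (\<exists>D. clone D \<and> clone_of J \<subset> D \<and> D \<subset> clone_of I)"
proof -
  obtain A where A: "A \<in> I" "infinite A"
    using \<open>ideal I\<close> by (auto simp: ideal_def)
  obtain P where P: "prime_ideal P" "A \<notin> P"
    "P \<notin> range (\<lambda>R. {G. {c. \<exists>g\<in>G. (c, g) \<in> R} \<in> I})"
    using exists_prime_ideal_not_in_range[OF assms(1) A(2),
        of "\<lambda>R. {G. {c. \<exists>g\<in>G. (c, g) \<in> R} \<in> I}"] by (elim exE conjE)
  have "countable A"
    by (rule countable_subset[OF subset_UNIV assms(1)])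
  then have "clone_of (I \<inter> P) \<subset> clone_of I"
    using clone_of_Int_subset[OF assms(3) P(1,3)]
      exists_operation_not_in_clone_of_Int[OF assms(3) P(1) A(1) P(2)] by blast
  moreover have "\<not> (\<exists>D. clone D \<and> clone_of (I \<inter> P) \<subset> D \<and> D \<subset> clone_of I)"
  proof
    assume "\<exists>D. clone D \<and> clone_of (I \<inter> P) \<subset> D \<and> D \<subset> clone_of I"
    then obtain D n g where D: "clone D" "clone_of (I \<inter> P) \<subset> D" "D \<subset> clone_of I"
      and g: "(n, g) \<in> D" "(n, g) \<notin> clone_of (I \<inter> P)"
      by fast
    then have "clone_of I \<subseteq> D"
      using clone_above_clone_of_Int[OF assms(3) P(1), of D n g] by blast
    with D(3) show False by blast
  qed
  ultimately show ?thesis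
    using ideal_Int_prime_ideal[OF assms(3) P(1)] by blast
qed

end
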